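(* Let $G$ be a cyclically $4$-edge-connected cubic graph. Let $C$ be a $2$-factor of $G$ containing exactly two odd circuits $N_1$ and $N_2$ (and possibly some even circuits). Let $e=x_1x_2$ be an edge of $G$ with $x_1\in V(N_1)$ and $x_2\in V(N_2)$. Let $F=G-E(C)$ (the perfect matching complementary to $C$) and let $M$ be a maximum matching in $C-\{x_1,x_2\}$. For $i\in\{1,2\}$ let $Z_i$ be the set of edges of $N_i$ that are not incident with $x_i$ but are incident with a neighbour of $x_i$ on $N_i$. Suppose there exist a smooth orientation of the circuits of the subgraph with edge set $(E(F)\setminus\{e\})\cup M$ and a smooth orientation of $C$ which agree on all edges of $Z_1\cup Z_2$. Then $fn(G)=2$.
   Context: A circuit is a connected $2$-regular graph; a cycle is a graph in which every vertex has even degree. A graph is cyclically $k$-edge-connected if the removal of fewer than $k$ edges cannot separate it into two components that both contain a cycle. A smooth orientation of a set of edge-disjoint circuits is an orientation in which, for every circuit of the set, each vertex of that circuit has exactly one incoming and one outgoing edge of that circuit. An orientation is strong if for every ordered pair of distinct vertices $u,v$ there is a directed $uv$-path. An edge $e$ is deletable in an orientation $(G,o)$ if the restriction of $o$ to $E(G)\setminus\{e\}$ is a strong orientation of $G-e$. For a $3$-edge-connected graph $G$, the Frank number $fn(G)$ is the minimum number $k$ such that $G$ admits $k$ orientations with the property that every edge of $G$ is deletable in at least one of them. *)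

theory Defs
  imports Main
begin

text \<open>Finite simple graphs: a vertex set V and a set E of 2-element subsets of V.
  Orientations are functions giving the head of each edge.\<close>

definition graph :: "'v set \<Rightarrow> 'v set set \<Rightarrow> bool" where
  "graph V E \<longleftrightarrow> finite V \<and> (\<forall>e\<in>E. e \<subseteq> V \<and> card e = 2)"

definition deg :: "'v set set \<Rightarrow> 'v \<Rightarrow> nat" where
  "deg E v = card {e\<in>E. v \<in> e}"

definition cubic :: "'v set \<Rightarrow> 'v set set \<Rightarrow> bool" where
  "cubic V E \<longleftrightarrow> graph V E \<and> (\<forall>v\<in>V. deg E v = 3)"

definition adj :: "'v set set \<Rightarrow> ('v \<times> 'v) set" where
  "adj E = {(u, v). {u, v} \<in> E}"

definition connected_graph :: "'v set \<Rightarrow> 'v set set \<Rightarrow> bool" where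
  "connected_graph W E \<longleftrightarrow> (\<forall>u\<in>W. \<forall>v\<in>W. (u, v) \<in> (adj E)\<^sup>*)"

text \<open>A circuit (connected 2-regular graph), given by its (nonempty) edge set.\<close>
definition circuit :: "'v set set \<Rightarrow> bool" where
  "circuit K \<longleftrightarrow> K \<noteq> {} \<and> finite K \<and> (\<forall>v\<in>\<Union>K. deg K v = 2) \<and> connected_graph (\<Union>K) K"

text \<open>The circuits of the graph with edge set H: circuits in H that are components of H.\<close>
definition circuits_of :: "'v set set \<Rightarrow> 'v set set set" where
  "circuits_of H = {K. K \<subseteq> H \<and> circuit K \<and> (\<forall>f\<in>H. f \<inter> \<Union>K \<noteq> {} \<longrightarrow> f \<in> K)}"

definition cyclically_k_edge_connected :: "'v set \<Rightarrow> 'v set set \<Rightarrow> nat \<Rightarrow> bool" where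
  "cyclically_k_edge_connected V E k \<longleftrightarrow>
     (\<forall>S\<subseteq>E. card S < k \<longrightarrow>
        \<not> (\<exists>X\<subseteq>V. (\<forall>f\<in>E - S. f \<subseteq> X \<or> f \<subseteq> V - X)
               \<and> (\<exists>K\<subseteq>E - S. circuit K \<and> \<Union>K \<subseteq> X)
               \<and> (\<exists>K\<subseteq>E - S. circuit K \<and> \<Union>K \<subseteq> V - X)))"

definition two_factor :: "'v set \<Rightarrow> 'v set set \<Rightarrow> 'v set set \<Rightarrow> bool" where
  "two_factor V E C \<longleftrightarrow> C \<subseteq> E \<and> (\<forall>v\<in>V. deg C v = 2)"

definition matching :: "'v set set \<Rightarrow> bool" where
  "matching M \<longleftrightarrow> (\<forall>e\<in>M. \<forall>f\<in>M. e \<noteq> f \<longrightarrow> e \<inter> f = {})"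

definition maximum_matching :: "'v set set \<Rightarrow> 'v set set \<Rightarrow> bool" where
  "maximum_matching H M \<longleftrightarrow> M \<subseteq> H \<and> matching M \<and>
     (\<forall>M'. M' \<subseteq> H \<and> matching M' \<longrightarrow> card M' \<le> card M)"

text \<open>Orientation: ori e is the head of edge e.\<close>
definition orientation :: "'v set set \<Rightarrow> ('v set \<Rightarrow> 'v) \<Rightarrow> bool" where
  "orientation E ori \<longleftrightarrow> (\<forall>e\<in>E. ori e \<in> e)"

text \<open>Smooth orientation of a set of edge-disjoint circuits.\<close>
definition smooth :: "'v set set set \<Rightarrow> ('v set \<Rightarrow> 'v) \<Rightarrow> bool" where
  "smooth Ks ori \<longleftrightarrow> (\<forall>K\<in>Ks. orientation K ori \<and>
     (\<forall>v\<in>\<Union>K. card {f\<in>K. v \<in> f \<and> ori f = v} = 1 \<and> card {f\<in>K. v \<in> f \<and> ori f \<noteq> v} = 1))"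

definition arcs :: "'v set set \<Rightarrow> ('v set \<Rightarrow> 'v) \<Rightarrow> ('v \<times> 'v) set" where
  "arcs E ori = {(u, v). {u, v} \<in> E \<and> u \<noteq> v \<and> ori {u, v} = v}"

definition strong :: "'v set \<Rightarrow> 'v set set \<Rightarrow> ('v set \<Rightarrow> 'v) \<Rightarrow> bool" where
  "strong V E ori \<longleftrightarrow> (\<forall>u\<in>V. \<forall>v\<in>V. u \<noteq> v \<longrightarrow> (u, v) \<in> (arcs E ori)\<^sup>+)"

definition deletable :: "'v set \<Rightarrow> 'v set set \<Rightarrow> ('v set \<Rightarrow> 'v) \<Rightarrow> 'v set \<Rightarrow> bool" where
  "deletable V E ori e \<longleftrightarrow> strong V (E - {e}) ori"

definition frank_number :: "'v set \<Rightarrow> 'v set set \<Rightarrow> nat" where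
  "frank_number V E = (LEAST k. \<exists>os :: nat \<Rightarrow> ('v set \<Rightarrow> 'v).
      (\<forall>i<k. orientation E (os i)) \<and> (\<forall>e\<in>E. \<exists>i<k. deletable V E (os i) e))"

end

theory Submission
  imports Defs
begin


text \<open>Let \<open>D = (E(F) - e) \<union> M\<close>. Even circuits, and odd circuits minus a vertex, have perfect matchings,
  so the maximum matching \<open>M\<close> covers every vertex except \<open>x\<^sub>1\<close> and \<open>x\<^sub>2\<close>,
  \<open>D\<close> is 2-regular off these two vertices, and the smooth orientations turn \<open>C\<close> and \<open>D\<close> into
  flows with values \<open>\<plusminus>1\<close>. The flows \<open>2C + D\<close> and \<open>C - 2D\<close> vanish only on \<open>e\<close>; orient the other edges
  so that the flow is positive, and orient \<open>e\<close> towards \<open>x\<^sub>2\<close> in the first and towards \<open>x\<^sub>1\<close> in the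
  second orientation. If \<open>g\<close> is not deletable, some edge cut has all its edges but \<open>g\<close> directed
  the same way, so the flow on \<open>g\<close> is the sum of the flows on the others. Cuts have at least three
  edges, and those with exactly three are stars of vertices. Hence edges of value 1 not incident
  with \<open>e\<close> are deletable, and every edge not incident with \<open>x\<^sub>1\<close> or \<open>x\<^sub>2\<close> has value 1 in one
  of the two flows; \<open>e\<close>, of value 0, is always deletable.
  Of the two edges of \<open>C\<close> at \<open>x\<^sub>i\<close>, one is deletable in the second orientation with value 1; the other
  has value 2 in the first, where the edge of \<open>Z\<^sub>i\<close> at its far end has value 3, which excludes
  the only possible cut. Two orientations are needed since every vertex of a cubic graph has
  in-degree or out-degree at most one.\<close>


subsection \<open>Edge cuts in cyclically 4-edge-connected cubic graphs\<close>

definition edge_cut :: "'v set set \<Rightarrow> 'v set \<Rightarrow> 'v set set" where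
  "edge_cut E X = {f\<in>E. f \<inter> X \<noteq> {} \<and> \<not> f \<subseteq> X}"

lemma finite_edges: "graph V E \<Longrightarrow> finite E"
  unfolding graph_def by (meson Pow_iff finite_Pow_iff finite_subset subsetI)

lemma graph_Union_edges:
  assumes "finite E" "\<forall>f\<in>E. card f = 2"
  shows "graph (\<Union>E) E"
proof -
  have "finite f" if "f \<in> E" for f using assms(2) that by (auto intro: card_ge_0_finite)
  then show ?thesis using assms unfolding graph_def by blast
qed

lemma edge_other_end:
  assumes "card f = 2" "v \<in> f"
  obtains w where "f = {v, w}" "w \<noteq> v"
proof -
  obtain a b where "f = {a, b}" "a \<noteq> b" using assms(1) by (auto simp: card_2_iff)
  then show thesis using assms(2) that[of a] that[of b] by (auto simp: insert_commute)
qed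

text \<open>Double counting of incidences: an edge inside \<open>X\<close> is counted at both ends,
  a cut edge at one.\<close>

lemma sum_deg:
  assumes g: "graph V E" and X: "X \<subseteq> V"
  shows "(\<Sum>v\<in>X. deg E v) = 2 * card {f\<in>E. f \<subseteq> X} + card (edge_cut E X)"
proof -
  have fE: "finite E" using g by (rule finite_edges)
  have fX: "finite X" using g X unfolding graph_def by (auto intro: finite_subset)
  have "(\<Sum>v\<in>X. deg E v) = (\<Sum>v\<in>X. \<Sum>f | f \<in> E \<and> v \<in> f. 1)"
    by (simp add: deg_def)
  also have "\<dots> = (\<Sum>f\<in>E. \<Sum>v | v \<in> X \<and> v \<in> f. 1)"
    by (rule sum.swap_restrict[OF fX fE])
  also have "\<dots> = (\<Sum>f\<in>E. (if f \<subseteq> X then 2 else 0) + (if f \<in> edge_cut E X then 1 else 0))"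
  proof (rule sum.cong[OF refl])
    fix f assume f: "f \<in> E"
    then obtain a b where "f = {a, b}" "a \<noteq> b"
      using g unfolding graph_def by (metis card_2_iff)
    then have "{v. v \<in> X \<and> v \<in> f} = (if a \<in> X then {a} else {}) \<union> (if b \<in> X then {b} else {})"
      by auto
    with \<open>f = {a, b}\<close> \<open>a \<noteq> b\<close> f
    show "(\<Sum>v | v \<in> X \<and> v \<in> f. 1) = (if f \<subseteq> X then 2 else 0) + (if f \<in> edge_cut E X then 1 else (0::nat))"
      by (auto simp: edge_cut_def)
  qed
  also have "\<dots> = 2 * card {f\<in>E. f \<subseteq> X} + card {f\<in>E. f \<in> edge_cut E X}"
    using fE by (simp add: sum.distrib sum.If_cases Int_def)
  also have "{f\<in>E. f \<in> edge_cut E X} = edge_cut E X" by (auto simp: edge_cut_def)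
  finally show ?thesis .
qed

lemma sum_deg_Union:
  assumes "finite K" "\<forall>f\<in>K. card f = 2"
  shows "(\<Sum>v\<in>\<Union>K. deg K v) = 2 * card K"
proof -
  have "edge_cut K (\<Union>K) = {}" "{f\<in>K. f \<subseteq> \<Union>K} = K" by (auto simp: edge_cut_def)
  then show ?thesis using sum_deg[OF graph_Union_edges[OF assms] subset_refl] by simp
qed

lemma adj_reach_sym: "(u, v) \<in> (adj E)\<^sup>* \<Longrightarrow> (v, u) \<in> (adj E)\<^sup>*"
proof -
  have "sym (adj E)" by (auto simp: sym_def adj_def insert_commute)
  then show "(u, v) \<in> (adj E)\<^sup>* \<Longrightarrow> (v, u) \<in> (adj E)\<^sup>*"
    by (meson symD sym_rtrancl)
qed

lemma edge_subset_reach: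
  assumes "card f = 2" "f \<in> E" "f \<inter> {w. (u, w) \<in> (adj E)\<^sup>*} \<noteq> {}"
  shows "f \<subseteq> {w. (u, w) \<in> (adj E)\<^sup>*}"
proof -
  from assms(3) obtain v where v: "v \<in> f" "(u, v) \<in> (adj E)\<^sup>*" by auto
  obtain w where w: "f = {v, w}" using edge_other_end[OF assms(1) v(1)] by metis
  then have "(v, w) \<in> adj E" using assms(2) by (simp add: adj_def)
  with v w show ?thesis by (auto intro: rtrancl_into_rtrancl)
qed

text \<open>A nonempty edge set that is minimal with at least as many edges as vertices is a circuit.\<close>

lemma exists_circuit:
  assumes "finite K" "\<forall>f\<in>K. card f = 2" "K \<noteq> {}" "card (\<Union>K) \<le> card K"
  shows "\<exists>L\<subseteq>K. circuit L"
  using assms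
proof (induction K rule: finite_psubset_induct)
  case (psubset K)
  note fK = psubset.hyps and c2 = psubset.prems(1) and ne = psubset.prems(2) and le = psubset.prems(3)
  have fU: "finite (\<Union>K)" using graph_Union_edges[OF fK c2] by (simp add: graph_def)
  show ?case
  proof (cases "\<exists>L. L \<subset> K \<and> L \<noteq> {} \<and> card (\<Union>L) \<le> card L")
    case True
    then obtain L where L: "L \<subset> K" "L \<noteq> {}" "card (\<Union>L) \<le> card L" by blast
    have "\<exists>L'\<subseteq>L. circuit L'" using psubset.IH[OF L(1)] L c2 by blast
    then show ?thesis using L(1) by blast
  next
    case False
    \<comment> \<open>From here \<open>K\<close> is minimal: each proper nonempty subset has fewer
      edges than vertices.\<close>
    then have small: "card L < card (\<Union>L)" if "L \<subset> K" "L \<noteq> {}" for L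
      using that False by (meson not_le)
    have rest: "K - {f} \<noteq> {}" if "f \<in> K" for f
    proof
      assume "K - {f} = {}"
      then have "K = {f}" using that by blast
      then show False using le c2 by simp
    qed
    have card_eq: "card (\<Union>K) = card K"
    proof -
      obtain f where f: "f \<in> K" using ne by blast
      have "card (K - {f}) < card (\<Union>(K - {f}))" using small[of "K - {f}"] rest f by blast
      also have "\<dots> \<le> card (\<Union>K)" using fU by (auto intro!: card_mono)
      finally show ?thesis using f fK le by simp
    qed
    \<comment> \<open>If only \<open>f\<close> met \<open>v\<close>, deleting \<open>f\<close> would
      lose one edge and at least one vertex, so \<open>K - {f}\<close> would contradict
      minimality.\<close>
    have deg_ge: "2 \<le> deg K v" if v: "v \<in> \<Union>K" for v
    proof (rule ccontr)
      assume "\<not> 2 \<le> deg K v"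
      then have le1: "card {f\<in>K. v \<in> f} \<le> 1" by (simp add: deg_def)
      obtain f where f: "f \<in> K" "v \<in> f" using v by blast
      have "h = f" if "h \<in> K" "v \<in> h" for h
        using le1 f that fK by (auto simp: card_le_Suc0_iff_eq)
      then have sub: "\<Union>(K - {f}) \<subseteq> \<Union>K - {v}" by blast
      have "card (K - {f}) < card (\<Union>(K - {f}))" using small[of "K - {f}"] rest f by blast
      also have "\<dots> \<le> card (\<Union>K - {v})" using fU sub by (auto intro!: card_mono)
      also have "\<dots> = card K - 1" using v fU card_eq by simp
      finally show False using f fK by simp
    qed
    \<comment> \<open>The degrees sum to twice the number of edges, which equals the number of
      vertices, so their average is 2 and none exceeds 2.\<close>
    have deg2: "deg K v = 2" if v: "v \<in> \<Union>K" for v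
    proof (rule ccontr)
      assume "deg K v \<noteq> 2"
      then have "2 < deg K v" using deg_ge[OF v] by simp
      then have "(\<Sum>v\<in>\<Union>K. 2) < (\<Sum>v\<in>\<Union>K. deg K v)"
        using fU v deg_ge by (intro sum_strict_mono_ex1) auto
      then show False using sum_deg_Union[OF fK c2] card_eq by simp
    qed
    have "connected_graph (\<Union>K) K"
      unfolding connected_graph_def
    proof (intro ballI, rule ccontr)
      fix u v assume u: "u \<in> \<Union>K" and v: "v \<in> \<Union>K" and nr: "(u, v) \<notin> (adj K)\<^sup>*"
      \<comment> \<open>The edges inside the reachability class of \<open>u\<close> and the other
        edges share no vertex. Each part has fewer edges than vertices, and adding the two
        contradicts \<open>card_eq\<close>.\<close>
      define W where "W = {w. (u, w) \<in> (adj K)\<^sup>*}"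
      define L where "L = {f\<in>K. f \<subseteq> W}"
      have LK: "L \<subseteq> K" by (auto simp: L_def)
      have dis: "f \<inter> W = {}" if "f \<in> K - L" for f
        using edge_subset_reach[of f K u] that c2 by (auto simp: L_def W_def)
      have "u \<in> W" "v \<notin> W" using nr by (auto simp: W_def)
      obtain f h where f: "f \<in> K" "u \<in> f" and h: "h \<in> K" "v \<in> h" using u v by blast
      have "f \<in> L" using dis f \<open>u \<in> W\<close> by blast
      moreover have "h \<notin> L" using h \<open>v \<notin> W\<close> by (auto simp: L_def)
      ultimately have "L \<subset> K" "L \<noteq> {}" "K - L \<subset> K" "K - L \<noteq> {}"
        using f h LK by auto
      then have "card L < card (\<Union>L)" "card (K - L) < card (\<Union>(K - L))"
        using small by blast+
      moreover have "card (\<Union>K) = card (\<Union>L) + card (\<Union>(K - L))"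
      proof -
        have U: "\<Union>K = \<Union>L \<union> \<Union>(K - L)" using LK by blast
        have "\<Union>L \<inter> \<Union>(K - L) = {}"
          using dis unfolding L_def by blast
        moreover have "finite (\<Union>L)" "finite (\<Union>(K - L))"
          using fU unfolding U by simp_all
        ultimately show ?thesis unfolding U by (intro card_Un_disjoint)
      qed
      moreover have "card (K - L) = card K - card L"
        using fK LK by (meson card_Diff_subset finite_subset)
      moreover have "card L \<le> card K" using fK LK by (rule card_mono)
      ultimately show False using card_eq by linarith
    qed
    then have "circuit K" using ne fK deg2 by (simp add: circuit_def)
    then show ?thesis by blast
  qed
qed

lemma cut_complement: "\<forall>f\<in>E. f \<subseteq> V \<Longrightarrow> X \<subseteq> V \<Longrightarrow> edge_cut E (V - X) = edge_cut E X"
  unfolding edge_cut_def by blast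

lemma cut_singleton: "\<forall>f\<in>E. card f = 2 \<Longrightarrow> edge_cut E {p} = {f\<in>E. p \<in> f}"
  unfolding edge_cut_def by (auto simp: subset_singleton_iff)

text \<open>Without a circuit, the edges inside \<open>X\<close>, if there are any, are fewer than
  its vertices. The degree sum \<open>3|X| = 2i + d\<close>, with \<open>i\<close> inner edges and
  \<open>d \<le> 3\<close> cut edges, then forces \<open>i = 0\<close> and
  \<open>|X| = 1\<close>.\<close>

lemma acyclic_side_is_vertex:
  assumes c: "cubic V E" and X: "X \<subseteq> V" "X \<noteq> {}" and le: "card (edge_cut E X) \<le> 3"
    and ac: "\<not> (\<exists>L\<subseteq>{f\<in>E. f \<subseteq> X}. circuit L)"
  shows "\<exists>p. X = {p}" and "card (edge_cut E X) = 3"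
proof -
  have g: "graph V E" using c by (simp add: cubic_def)
  let ?I = "{f\<in>E. f \<subseteq> X}"
  have fI: "finite ?I" using finite_edges[OF g] by simp
  have fX: "finite X" using g X by (auto simp: graph_def intro: finite_subset)
  have "(\<Sum>v\<in>X. deg E v) = (\<Sum>v\<in>X. 3)"
    using c X by (intro sum.cong) (auto simp: cubic_def)
  then have s: "3 * card X = 2 * card ?I + card (edge_cut E X)"
    using sum_deg[OF g X(1)] by simp
  have cX: "card X > 0" using fX X by (simp add: card_gt_0_iff)
  have "?I = {}"
  proof (rule ccontr)
    assume ne: "?I \<noteq> {}"
    have "\<not> card (\<Union>?I) \<le> card ?I"
      using exists_circuit[OF fI _ ne] ac g by (auto simp: graph_def)
    moreover have "card (\<Union>?I) \<le> card X" using fX by (auto intro!: card_mono)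
    ultimately have lt: "card ?I < card X" by linarith
    have "card ?I > 0" using fI ne by (simp add: card_gt_0_iff)
    then show False using s lt le by linarith
  qed
  then have "3 * card X = card (edge_cut E X)" using s by (metis card.empty mult_0_right add_0)
  then have "card X = 1 \<and> card (edge_cut E X) = 3" using le cX by linarith
  then show "\<exists>p. X = {p}" "card (edge_cut E X) = 3" by (auto simp: card_1_singleton_iff)
qed

text \<open>Circuits on both sides would violate cyclic 4-edge-connectivity, so one side has none
  and is a single vertex. The conclusion speaks of the star of \<open>p\<close> and not of
  \<open>X\<close>, since the single vertex may be the complement.\<close>

lemma small_cut:
  assumes c: "cubic V E" and cyc: "cyclically_k_edge_connected V E 4"
    and X: "X \<subset> V" "X \<noteq> {}" and le: "card (edge_cut E X) \<le> 3"
  shows "card (edge_cut E X) = 3" "\<exists>p. edge_cut E X = {f\<in>E. p \<in> f}"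
proof -
  have g: "\<forall>f\<in>E. f \<subseteq> V" "\<forall>f\<in>E. card f = 2" using c by (auto simp: cubic_def graph_def)
  have sub: "edge_cut E X \<subseteq> E" by (auto simp: edge_cut_def)
  have sides: "\<forall>f\<in>E - edge_cut E X. f \<subseteq> X \<or> f \<subseteq> V - X" using g X by (auto simp: edge_cut_def)
  have compl: "edge_cut E (V - X) = edge_cut E X" using cut_complement[OF g(1)] X by blast
  have in_rest: "L \<subseteq> E - edge_cut E X \<and> \<Union>L \<subseteq> Y" if "L \<subseteq> {f\<in>E. f \<subseteq> Y}" "Y = X \<or> Y = V - X" for L Y
    using that by (auto simp: edge_cut_def)
  have "\<not> ((\<exists>L\<subseteq>{f\<in>E. f \<subseteq> X}. circuit L) \<and> (\<exists>L\<subseteq>{f\<in>E. f \<subseteq> V - X}. circuit L))"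
  proof (rule notI, elim conjE exE)
    fix L R assume "L \<subseteq> {f\<in>E. f \<subseteq> X}" "circuit L" "R \<subseteq> {f\<in>E. f \<subseteq> V - X}" "circuit R"
    then have "\<exists>K\<subseteq>E - edge_cut E X. circuit K \<and> \<Union>K \<subseteq> X"
      and "\<exists>K\<subseteq>E - edge_cut E X. circuit K \<and> \<Union>K \<subseteq> V - X"
      using in_rest[of L X] in_rest[of R "V - X"] by blast+
    then show False
      using cyc[unfolded cyclically_k_edge_connected_def, rule_format, OF sub] sides le X(1) by auto
  qed
  moreover have "V - X \<noteq> {}" "X \<subseteq> V" using X by auto
  ultimately have "(\<exists>p. X = {p} \<or> V - X = {p}) \<and> card (edge_cut E X) = 3"
    using acyclic_side_is_vertex[OF c, of X] acyclic_side_is_vertex[OF c, of "V - X"] X(2) le compl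
    by auto
  then show "card (edge_cut E X) = 3" "\<exists>p. edge_cut E X = {f\<in>E. p \<in> f}"
    using compl cut_singleton[OF g(2)] by metis+
qed

subsection \<open>Flows and deletable edges\<close>

text \<open>\<open>\<phi> f v\<close> is the signed amount that \<open>f\<close> delivers to its end
  \<open>v\<close>. Antisymmetry on edges and conservation at vertices then both read as zero sums,
  and no reference orientation is fixed.\<close>

definition flow :: "'v set \<Rightarrow> 'v set set \<Rightarrow> ('v set \<Rightarrow> 'v \<Rightarrow> int) \<Rightarrow> bool" where
  "flow V E \<phi> \<longleftrightarrow> (\<forall>f\<in>E. (\<Sum>v\<in>f. \<phi> f v) = 0) \<and> (\<forall>v\<in>V. (\<Sum>f | f \<in> E \<and> v \<in> f. \<phi> f v) = 0)"

text \<open>Conservation is summed over \<open>X\<close>; an edge with both ends in \<open>X\<close>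
  cancels, so only cut edges remain.\<close>

lemma flow_across_cut:
  assumes g: "graph V E" and fl: "flow V E \<phi>" and X: "X \<subseteq> V"
  shows "(\<Sum>f\<in>edge_cut E X. \<Sum>v\<in>f \<inter> X. \<phi> f v) = 0"
proof -
  have fE: "finite E" using g by (rule finite_edges)
  have fX: "finite X" using g X unfolding graph_def by (auto intro: finite_subset)
  have "0 = (\<Sum>v\<in>X. \<Sum>f | f \<in> E \<and> v \<in> f. \<phi> f v)"
    using fl X by (subst sum.neutral) (auto simp: flow_def)
  also have "\<dots> = (\<Sum>f\<in>E. \<Sum>v | v \<in> X \<and> v \<in> f. \<phi> f v)"
    by (rule sum.swap_restrict[OF fX fE])
  also have "\<dots> = (\<Sum>f\<in>E. \<Sum>v\<in>f \<inter> X. \<phi> f v)"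
    by (intro sum.cong) auto
  also have "\<dots> = (\<Sum>f\<in>edge_cut E X. \<Sum>v\<in>f \<inter> X. \<phi> f v)"
  proof (rule sum.mono_neutral_right[OF fE])
    show "\<forall>f\<in>E - edge_cut E X. (\<Sum>v\<in>f \<inter> X. \<phi> f v) = 0"
    proof
      fix f assume f: "f \<in> E - edge_cut E X"
      then have "f \<inter> X = {} \<or> f \<inter> X = f" by (auto simp: edge_cut_def)
      then show "(\<Sum>v\<in>f \<inter> X. \<phi> f v) = 0" using fl f by (auto simp: flow_def)
    qed
  qed (auto simp: edge_cut_def)
  finally show ?thesis by simp
qed

text \<open>\<open>X\<close> consists of the vertices reachable from some \<open>u\<close> that
  fails to reach every vertex. No edge leaves it, so the cut edges point into it.\<close>

lemma not_strong_closed_set: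
  assumes g: "graph V E" and E': "E' \<subseteq> E" and ori: "orientation E ori" and ns: "\<not> strong V E' ori"
  obtains X where "X \<subset> V" "X \<noteq> {}" "\<forall>f\<in>edge_cut E' X. ori f \<in> X"
proof -
  obtain u v where uv: "u \<in> V" "v \<in> V" "u \<noteq> v" "(u, v) \<notin> (arcs E' ori)\<^sup>+"
    using ns by (auto simp: strong_def)
  let ?X = "{w\<in>V. (u, w) \<in> (arcs E' ori)\<^sup>*}"
  have "v \<notin> ?X" using uv by (auto simp: rtrancl_eq_or_trancl)
  moreover have "u \<in> ?X" using uv by simp
  moreover have "ori f \<in> ?X" if f: "f \<in> edge_cut E' ?X" for f
  proof -
    have fE: "f \<in> E" "f \<in> E'" using f E' by (auto simp: edge_cut_def)
    obtain a where a: "a \<in> f" "a \<in> ?X" using f by (auto simp: edge_cut_def)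
    have f2: "f \<subseteq> V" "card f = 2" using g fE by (auto simp: graph_def)
    obtain b where b: "f = {a, b}" "b \<noteq> a" using edge_other_end[OF f2(2) a(1)] by metis
    have "ori f = a \<or> ori f = b" using ori fE b by (auto simp: orientation_def)
    moreover have "b \<in> ?X" if "ori f = b"
    proof -
      have "(a, b) \<in> arcs E' ori" using b fE that by (auto simp: arcs_def)
      then show ?thesis using a b f2 by (auto intro: rtrancl_into_rtrancl)
    qed
    ultimately show ?thesis using a by auto
  qed
  ultimately show ?thesis using that[of ?X] uv by blast
qed

text \<open>All cut edges other than \<open>g\<close> enter a closed set \<open>X\<close> of the
  graph without \<open>g\<close>. If \<open>g\<close> did not leave \<open>X\<close>, nonnegative
  values would sum to zero over the cut; all would vanish, leaving at most \<open>e\<close> in a cut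
  of at least three edges. Hence \<open>g\<close> leaves \<open>X\<close> and balances the
  rest.\<close>

lemma nondeletable_cut:
  assumes c: "cubic V E" and cyc: "cyclically_k_edge_connected V E 4"
    and fl: "flow V E \<phi>" and ori: "orientation E ori" and pos: "\<forall>f\<in>E. f \<noteq> e \<longrightarrow> \<phi> f (ori f) > 0"
    and e0: "\<phi> e (ori e) \<ge> 0" and nd: "\<not> deletable V E ori g"
  obtains X where "X \<subset> V" "X \<noteq> {}" "g \<in> edge_cut E X" "ori g \<notin> X" "\<forall>f\<in>edge_cut E X - {g}. ori f \<in> X"
    "(\<Sum>f\<in>edge_cut E X - {g}. \<phi> f (ori f)) = \<phi> g (ori g)"
proof -
  have gr: "graph V E" using c by (simp add: cubic_def)
  obtain X where X: "X \<subset> V" "X \<noteq> {}" and cl0: "\<forall>f\<in>edge_cut (E - {g}) X. ori f \<in> X"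
    using not_strong_closed_set[OF gr Diff_subset ori] nd unfolding deletable_def by metis
  have cl: "\<forall>f\<in>edge_cut E X - {g}. ori f \<in> X" using cl0 by (auto simp: edge_cut_def)
  have fin: "finite (edge_cut E X)" using finite_edges[OF gr] by (simp add: edge_cut_def)
  have card3: "3 \<le> card (edge_cut E X)"
    using small_cut(1)[OF c cyc X] by linarith
  have zero: "(\<Sum>f\<in>edge_cut E X. \<Sum>v\<in>f \<inter> X. \<phi> f v) = 0"
    using flow_across_cut[OF gr fl] X by blast
  \<comment> \<open>A cut edge has exactly one end in \<open>X\<close>, and the flow at its tail is
    the negative of that at its head.\<close>
  have ends: "(ori f \<in> X \<and> (\<Sum>v\<in>f \<inter> X. \<phi> f v) = \<phi> f (ori f)) \<or>
              (ori f \<notin> X \<and> (\<Sum>v\<in>f \<inter> X. \<phi> f v) = - \<phi> f (ori f))" if f: "f \<in> edge_cut E X" for f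
  proof -
    have fE: "f \<in> E" using f by (simp add: edge_cut_def)
    have of: "ori f \<in> f" using ori fE by (simp add: orientation_def)
    have "card f = 2" using gr fE by (simp add: graph_def)
    then obtain w where w: "f = {ori f, w}" "w \<noteq> ori f" using edge_other_end[OF _ of] by metis
    have "(\<Sum>v\<in>{ori f, w}. \<phi> f v) = 0" using fl fE w(1) by (simp add: flow_def)
    then have s: "\<phi> f (ori f) + \<phi> f w = 0" using w(2) by simp
    have "\<not> {ori f, w} \<subseteq> X" "{ori f, w} \<inter> X \<noteq> {}"
      using f unfolding w(1)[symmetric] by (auto simp: edge_cut_def)
    then have one_in: "ori f \<in> X \<longleftrightarrow> w \<notin> X" by auto
    show ?thesis
    proof (cases "ori f \<in> X")
      case True
      then have "f \<inter> X = {ori f}" using one_in by (subst w(1)) auto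
      then show ?thesis using True by simp
    next
      case False
      then have "f \<inter> X = {w}" using one_in by (subst w(1)) auto
      then show ?thesis using False s by simp
    qed
  qed
  have nonneg: "\<phi> f (ori f) \<ge> 0" if "f \<in> E" for f
    using pos e0 that by (cases "f = e") (auto intro: less_imp_le)
  have gout: "g \<in> edge_cut E X \<and> ori g \<notin> X"
  proof (rule ccontr)
    assume "\<not> (g \<in> edge_cut E X \<and> ori g \<notin> X)"
    then have all: "\<forall>f\<in>edge_cut E X. ori f \<in> X" using cl by blast
    have "(\<Sum>f\<in>edge_cut E X. \<phi> f (ori f)) = (\<Sum>f\<in>edge_cut E X. \<Sum>v\<in>f \<inter> X. \<phi> f v)"
      using ends all by (intro sum.cong) auto
    then have "(\<Sum>f\<in>edge_cut E X. \<phi> f (ori f)) = 0" using zero by simp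
    then have "\<forall>f\<in>edge_cut E X. \<phi> f (ori f) = 0"
      using fin nonneg by (subst (asm) sum_nonneg_eq_0_iff) (auto simp: edge_cut_def)
    then have "f = e" if "f \<in> edge_cut E X" for f
      using pos[rule_format, of f] that by (cases "f = e") (auto simp: edge_cut_def)
    then have "edge_cut E X \<subseteq> {e}" by blast
    then have "card (edge_cut E X) \<le> 1" using card_mono[of "{e}"] by simp
    then show False using card3 by simp
  qed
  have "(\<Sum>f\<in>edge_cut E X - {g}. \<phi> f (ori f)) = (\<Sum>f\<in>edge_cut E X - {g}. \<Sum>v\<in>f \<inter> X. \<phi> f v)"
  proof (rule sum.cong[OF refl])
    fix f assume "f \<in> edge_cut E X - {g}"
    then show "\<phi> f (ori f) = (\<Sum>v\<in>f \<inter> X. \<phi> f v)" using ends[of f] cl by auto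
  qed
  moreover have "(\<Sum>v\<in>g \<inter> X. \<phi> g v) = - \<phi> g (ori g)" using ends gout by blast
  moreover have "(\<Sum>f\<in>edge_cut E X. \<Sum>v\<in>f \<inter> X. \<phi> f v)
      = (\<Sum>v\<in>g \<inter> X. \<phi> g v) + (\<Sum>f\<in>edge_cut E X - {g}. \<Sum>v\<in>f \<inter> X. \<phi> f v)"
    using gout fin by (intro sum.remove) auto
  ultimately have "(\<Sum>f\<in>edge_cut E X - {g}. \<phi> f (ori f)) = \<phi> g (ori g)" using zero by simp
  with that[OF X] gout cl show thesis by blast
qed

text \<open>A cut through \<open>e\<close> of size three is the star of an end of \<open>e\<close>; an edge \<open>g\<close> sharing an end
  with \<open>e\<close> can only leave a cut alone if \<open>e\<close> is not in it, provided both edges have the same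
  direction at the common end.\<close>

lemma deletable_if_flow:
  assumes c: "cubic V E" and cyc: "cyclically_k_edge_connected V E 4"
    and fl: "flow V E \<phi>" and ori: "orientation E ori" and pos: "\<forall>f\<in>E. f \<noteq> e \<longrightarrow> \<phi> f (ori f) > 0"
    and e: "e \<in> E" "\<phi> e (ori e) = 0" and g: "g \<in> E"
    and same: "\<And>x. x \<in> e \<Longrightarrow> x \<in> g \<Longrightarrow> g \<noteq> e \<Longrightarrow> ori e = x \<longleftrightarrow> ori g = x"
    and val: "\<phi> g (ori g) \<le> 1 \<or> \<phi> g (ori g) = 2 \<and> e \<inter> g \<noteq> {} \<and>
      (\<forall>y\<in>g - e. \<exists>z\<in>E. y \<in> z \<and> z \<noteq> g \<and> \<phi> z (ori z) > 1)"
  shows "deletable V E ori g"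
proof (rule ccontr)
  assume nd: "\<not> deletable V E ori g"
  have gr: "graph V E" using c by (simp add: cubic_def)
  obtain X where X: "X \<subset> V" "X \<noteq> {}" and gX: "g \<in> edge_cut E X" "ori g \<notin> X"
    and cl: "\<forall>f\<in>edge_cut E X - {g}. ori f \<in> X"
    and s: "(\<Sum>f\<in>edge_cut E X - {g}. \<phi> f (ori f)) = \<phi> g (ori g)"
    using nondeletable_cut[OF c cyc fl ori pos _ nd] e by (metis order_refl)
  let ?D = "edge_cut E X - {g}"
  have fin: "finite (edge_cut E X)" using finite_edges[OF gr] by (simp add: edge_cut_def)
  have card3: "3 \<le> card (edge_cut E X)" using small_cut(1)[OF c cyc X] by linarith
  have cD: "card ?D = card (edge_cut E X) - 1" using gX fin by simp
  \<comment> \<open>Since \<open>e\<close> carries no flow it drops out of the sum, although it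
    still counts towards the size of the cut.\<close>
  have "(\<Sum>f\<in>?D - {e}. \<phi> f (ori f)) = (\<Sum>f\<in>?D. \<phi> f (ori f))"
    using fin e by (intro sum.mono_neutral_left) auto
  then have s': "(\<Sum>f\<in>?D - {e}. \<phi> f (ori f)) = \<phi> g (ori g)" using s by simp
  have pos': "\<forall>f\<in>?D - {e}. 1 \<le> \<phi> f (ori f)" using pos by (auto simp: edge_cut_def int_one_le_iff_zero_less)
  then have "(\<Sum>f\<in>?D - {e}. 1) \<le> (\<Sum>f\<in>?D - {e}. \<phi> f (ori f))" by (intro sum_mono) auto
  then have le: "int (card (?D - {e})) \<le> \<phi> g (ori g)" using s' by simp
  \<comment> \<open>\<open>e\<close> enters \<open>X\<close> while \<open>g\<close> leaves it, which
    is impossible if both point towards, or both away from, a common end.\<close>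
  have disj: "e \<inter> g = {}" if eD: "e \<in> ?D"
  proof (rule ccontr)
    assume "e \<inter> g \<noteq> {}"
    then obtain x where x: "x \<in> e" "x \<in> g" by blast
    have "g \<noteq> e" using eD by blast
    with same x have sm: "ori e = x \<longleftrightarrow> ori g = x" by blast
    have "card g = 2" "card e = 2" using gr g e by (auto simp: graph_def)
    then obtain y w where y: "g = {x, y}" "y \<noteq> x" and w: "e = {x, w}" "w \<noteq> x"
      using edge_other_end x by metis
    have "ori g \<in> g" "ori e \<in> e" using ori g e by (auto simp: orientation_def)
    then have "ori g = x \<or> ori g = y" "ori e = x \<or> ori e = w" using y(1) w(1) by auto
    moreover have "ori e \<in> X" using cl eD by blast
    moreover have "\<not> {x, y} \<inter> X = {}" "\<not> {x, w} \<subseteq> X"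
      using gX eD unfolding y(1)[symmetric] w(1)[symmetric] by (auto simp: edge_cut_def)
    ultimately show False using sm gX(2) by auto
  qed
  show False
  proof (cases "e \<in> ?D")
    \<comment> \<open>At most one further edge joins \<open>e\<close> and \<open>g\<close>, so the
      cut is a star, and its centre would lie on both \<open>e\<close> and \<open>g\<close>.\<close>
    case True
    then have "\<phi> g (ori g) \<le> 1" using val disj by blast
    then have "card (?D - {e}) \<le> 1" using le by linarith
    then have "card (edge_cut E X) = 3" using True fin cD card3 by simp
    then obtain p where p: "edge_cut E X = {f\<in>E. p \<in> f}" using small_cut(2)[OF c cyc X] by auto
    then show False using True gX disj by blast
  next
    case False
    then have D: "?D - {e} = ?D" by blast
    then have two: "2 \<le> card (?D - {e})" using cD card3 by simp
    then have v2: "\<phi> g (ori g) = 2" and eg: "e \<inter> g \<noteq> {}"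
      and z: "\<forall>y\<in>g - e. \<exists>z\<in>E. y \<in> z \<and> z \<noteq> g \<and> \<phi> z (ori z) > 1"
      using le val by auto
    have "card (edge_cut E X) = 3" using le v2 two cD D by simp
    then obtain p where p: "edge_cut E X = {f\<in>E. p \<in> f}" using small_cut(2)[OF c cyc X] by auto
    have "g \<noteq> e" using v2 e by auto
    \<comment> \<open>The centre \<open>p\<close> is not on \<open>e\<close>, because
      \<open>e\<close> is outside the cut. The edge obtained at \<open>p\<close> has value above 1,
      while two positive integers have to sum to 2.\<close>
    then have "p \<in> g - e" using p gX False e(1) by auto
    then obtain h where h: "h \<in> E" "p \<in> h" "h \<noteq> g" "\<phi> h (ori h) > 1" using z by blast
    then have hD: "h \<in> ?D - {e}" using p D by blast
    have "(\<Sum>f\<in>?D - {e}. 1) < (\<Sum>f\<in>?D - {e}. \<phi> f (ori f))"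
      using pos' fin hD h(4) by (intro sum_strict_mono_ex1) auto
    then show False using s' v2 two by simp
  qed
qed

text \<open>Values vanish off \<open>H\<close>, so that flows of different subgraphs can be combined
  as flows on \<open>E\<close>.\<close>

definition unit_flow :: "'v set set \<Rightarrow> ('v set \<Rightarrow> 'v) \<Rightarrow> 'v set \<Rightarrow> 'v \<Rightarrow> int" where
  "unit_flow H ori f v = (if f \<in> H \<and> v \<in> f then if ori f = v then 1 else - 1 else 0)"

text \<open>The net value at a vertex is in-degree minus out-degree in \<open>H\<close>, which is 1
  - 1 on \<open>H\<close> and 0 elsewhere.\<close>

lemma flow_unit_flow:
  assumes g: "graph V E" and HE: "H \<subseteq> E" and ori: "\<forall>f\<in>H. ori f \<in> f"
    and bal: "\<forall>v\<in>\<Union>H. card {f\<in>H. v \<in> f \<and> ori f = v} = 1 \<and> card {f\<in>H. v \<in> f \<and> ori f \<noteq> v} = 1"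
  shows "flow V E (unit_flow H ori)"
  unfolding flow_def
proof (intro conjI ballI)
  fix f assume f: "f \<in> E"
  show "(\<Sum>v\<in>f. unit_flow H ori f v) = 0"
  proof (cases "f \<in> H")
    case True
    obtain w where w: "f = {ori f, w}" "w \<noteq> ori f"
      using edge_other_end[of f "ori f"] g f ori True by (metis graph_def)
    have "w \<in> f" using w(1) by blast
    then have "unit_flow H ori f (ori f) + unit_flow H ori f w = 0"
      using w(2) True ori by (simp add: unit_flow_def)
    then have "(\<Sum>v\<in>{ori f, w}. unit_flow H ori f v) = 0" using w(2) by simp
    then show ?thesis using w(1) by simp
  qed (simp add: unit_flow_def)
next
  fix v assume "v \<in> V"
  have fH: "finite H" using finite_edges[OF g] HE by (rule finite_subset[rotated])
  have "(\<Sum>f | f \<in> E \<and> v \<in> f. unit_flow H ori f v) = (\<Sum>f | f \<in> H \<and> v \<in> f. unit_flow H ori f v)"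
    using finite_edges[OF g] HE by (intro sum.mono_neutral_right) (auto simp: unit_flow_def)
  also have "\<dots> = (\<Sum>f | f \<in> H \<and> v \<in> f. if ori f = v then 1 else - 1)"
    by (intro sum.cong) (auto simp: unit_flow_def)
  also have "\<dots> = int (card {f\<in>H. v \<in> f \<and> ori f = v}) - int (card {f\<in>H. v \<in> f \<and> ori f \<noteq> v})"
    using fH by (simp add: sum.If_cases Int_def conj_ac)
  also have "\<dots> = 0"
  proof (cases "v \<in> \<Union>H")
    case False
    then have "{f\<in>H. v \<in> f \<and> ori f = v} = {}" "{f\<in>H. v \<in> f \<and> ori f \<noteq> v} = {}" by auto
    then show ?thesis by (simp only: card.empty)
  qed (use bspec[OF bal, of v] in simp)
  finally show "(\<Sum>f | f \<in> E \<and> v \<in> f. unit_flow H ori f v) = 0" .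
qed

lemma flow_lincomb:
  assumes "flow V E \<phi>" "flow V E \<psi>"
  shows "flow V E (\<lambda>f v. a * \<phi> f v + b * \<psi> f v)"
  using assms unfolding flow_def sum.distrib sum_distrib_left[symmetric] by simp

text \<open>Where the flow is nonzero, exactly one end of an edge has a positive value, and it
  becomes the head. Only \<open>e\<close>, where the flow may vanish, is directed by choice. The
  last clause lets direction and size be read off at either end.\<close>

lemma flow_orientation:
  assumes g: "graph V E" and fl: "flow V E \<phi>" and nz: "\<forall>f\<in>E. f \<noteq> e \<longrightarrow> (\<forall>v\<in>f. \<phi> f v \<noteq> 0)"
    and x: "x \<in> e"
  obtains ori where "orientation E ori" "ori e = x" "\<forall>f\<in>E. f \<noteq> e \<longrightarrow> \<phi> f (ori f) > 0"
    "\<And>f v. f \<in> E \<Longrightarrow> f \<noteq> e \<Longrightarrow> v \<in> f \<Longrightarrow> (ori f = v \<longleftrightarrow> \<phi> f v > 0) \<and> \<phi> f (ori f) = \<bar>\<phi> f v\<bar>"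
proof -
  define ori where "ori f = (if f = e then x else SOME v. v \<in> f \<and> \<phi> f v > 0)" for f
  have main: "ori f \<in> f \<and> \<phi> f (ori f) > 0 \<and>
      (\<forall>v\<in>f. (ori f = v \<longleftrightarrow> \<phi> f v > 0) \<and> \<phi> f (ori f) = \<bar>\<phi> f v\<bar>)" if f: "f \<in> E" "f \<noteq> e" for f
  proof -
    obtain a b where ab: "f = {a, b}" "a \<noteq> b" using g f by (metis graph_def card_2_iff)
    have "(\<Sum>v\<in>f. \<phi> f v) = 0" using fl f by (simp add: flow_def)
    then have s: "\<phi> f a + \<phi> f b = 0" using ab by simp
    have n: "\<phi> f a \<noteq> 0" using nz[rule_format, of f a] f ab by simp
    have "\<exists>v. v \<in> f \<and> \<phi> f v > 0"
    proof (cases "\<phi> f a > 0")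
      case False
      then have "\<phi> f b > 0" using s n by linarith
      then show ?thesis using ab by blast
    qed (use ab in blast)
    then have "ori f \<in> f \<and> \<phi> f (ori f) > 0" using someI_ex f by (simp add: ori_def)
    moreover from this have "ori f = a \<or> ori f = b" using ab by blast
    ultimately show ?thesis using s n ab by (elim disjE) auto
  qed
  have "orientation E ori"
    unfolding orientation_def using main x by (metis ori_def)
  then show thesis using that[of ori] main by (simp add: ori_def)
qed

text \<open>One orientation never suffices: of the three edges at \<open>v\<close>, at most one
  enters or at most one leaves. Deleting it leaves \<open>v\<close> with no entering or no leaving
  edge.\<close>

lemma exists_nondeletable:
  assumes c: "cubic V E" and v: "v \<in> V" and ori: "orientation E ori"
  shows "\<exists>g\<in>E. \<not> deletable V E ori g"
proof -
  have g: "graph V E" using c by (simp add: cubic_def)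
  let ?A = "{f\<in>E. v \<in> f \<and> ori f = v}" and ?B = "{f\<in>E. v \<in> f \<and> ori f \<noteq> v}"
  have fin: "finite ?A" "finite ?B" using finite_edges[OF g] by auto
  have "card (?A \<union> ?B) = card ?A + card ?B" using fin by (intro card_Un_disjoint) auto
  moreover have "?A \<union> ?B = {f\<in>E. v \<in> f}" by auto
  moreover have d: "card {f\<in>E. v \<in> f} = 3" using c v by (auto simp: cubic_def deg_def)
  ultimately have "card ?A \<le> 1 \<or> card ?B \<le> 1" by simp linarith
  moreover have "{f\<in>E. v \<in> f} \<noteq> {}" using d by force
  then obtain h where h: "h \<in> E" "v \<in> h" by blast
  then obtain u where u: "h = {v, u}" "u \<noteq> v" using edge_other_end[of h v] g by (metis graph_def)
  have uV: "u \<in> V" using h u g by (auto simp: graph_def)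
  \<comment> \<open>If no edge at \<open>v\<close> has the given direction, any edge serves, here
    \<open>h\<close>.\<close>
  have only: "\<exists>k\<in>E. S \<subseteq> {k}" if "card S \<le> 1" "finite S" "S \<subseteq> E" for S :: "'a set set"
  proof (cases "S = {}")
    case False
    then have "card S = 1" using that by (simp add: card_gt_0_iff le_antisym Suc_leI)
    then obtain k where "S = {k}" by (rule card_1_singletonE)
    then show ?thesis using that by blast
  qed (use h in blast)
  ultimately show ?thesis
  proof (elim disjE)
    assume "card ?A \<le> 1"
    then obtain k where k: "k \<in> E" "?A \<subseteq> {k}" using only[of ?A] fin by blast
    have "(u, v) \<notin> (arcs (E - {k}) ori)\<^sup>+"
    proof
      assume "(u, v) \<in> (arcs (E - {k}) ori)\<^sup>+"
      then obtain w where "(w, v) \<in> arcs (E - {k}) ori" by (meson tranclE)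
      then show False using k by (auto simp: arcs_def)
    qed
    then show ?thesis using k u uV v by (auto simp: deletable_def strong_def)
  next
    assume "card ?B \<le> 1"
    then obtain k where k: "k \<in> E" "?B \<subseteq> {k}" using only[of ?B] fin by blast
    have "(v, u) \<notin> (arcs (E - {k}) ori)\<^sup>+"
    proof
      assume "(v, u) \<in> (arcs (E - {k}) ori)\<^sup>+"
      then obtain w where "(v, w) \<in> arcs (E - {k}) ori" by (meson tranclD)
      then show False using k by (auto simp: arcs_def)
    qed
    moreover have "v \<noteq> u" using u by simp
    ultimately show ?thesis using k uV v by (auto simp: deletable_def strong_def)
  qed
qed

subsection \<open>Circuits and maximum matchings of a 2-regular graph\<close>

text \<open>The component is formed by the edges meeting the reachability class \<open>W\<close> of
  \<open>x\<close>. They lie inside \<open>W\<close>, so a vertex of the component keeps all its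
  edges and hence degree 2.\<close>

lemma two_regular_component:
  assumes fin: "finite H" and c2: "\<forall>f\<in>H. card f = 2" and d2: "\<forall>v\<in>\<Union>H. deg H v = 2" and x: "x \<in> \<Union>H"
  shows "\<exists>K\<in>circuits_of H. x \<in> \<Union>K"
proof -
  define W where "W = {w. (x, w) \<in> (adj H)\<^sup>*}"
  define K where "K = {f\<in>H. f \<inter> W \<noteq> {}}"
  have inW: "f \<subseteq> W" if "f \<in> K" for f
    using edge_subset_reach[of f H x] that c2 by (auto simp: K_def W_def)
  have xW: "x \<in> W" by (simp add: W_def)
  then have xK: "x \<in> \<Union>K" using x by (auto simp: K_def)
  have "deg K v = 2" if "v \<in> \<Union>K" for v
  proof -
    have "{f\<in>K. v \<in> f} = {f\<in>H. v \<in> f}" using inW that by (auto simp: K_def)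
    moreover have "v \<in> \<Union>H" using that by (auto simp: K_def)
    ultimately show ?thesis using bspec[OF d2, of v] by (simp add: deg_def)
  qed
  moreover have reach: "(x, w) \<in> (adj K)\<^sup>*" if "w \<in> W" for w
  proof -
    have "(x, w) \<in> (adj H)\<^sup>*" using that by (simp add: W_def)
    then show ?thesis
    proof (induction rule: rtrancl_induct)
      case (step y z)
      have "y \<in> W" using step.hyps by (simp add: W_def)
      then have "(y, z) \<in> adj K" using step.hyps by (auto simp: adj_def K_def)
      with step.IH show ?case by (rule rtrancl_into_rtrancl)
    qed simp
  qed
  have "connected_graph (\<Union>K) K"
    unfolding connected_graph_def
  proof (intro ballI)
    fix u v assume "u \<in> \<Union>K" "v \<in> \<Union>K"
    then have "u \<in> W" "v \<in> W" using inW by auto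
    then show "(u, v) \<in> (adj K)\<^sup>*"
      using reach adj_reach_sym by (metis rtrancl_trans)
  qed
  ultimately have "circuit K" using fin xK by (auto simp: circuit_def K_def)
  moreover have "f \<in> K" if "f \<in> H" "f \<inter> \<Union>K \<noteq> {}" for f
    using that inW by (auto simp: K_def)
  ultimately have "K \<in> circuits_of H" by (auto simp: circuits_of_def K_def)
  with xK show ?thesis by blast
qed

text \<open>Following the orientation around the circuit from \<open>x\<close> gives vertices
  \<open>a 0, \<dots>, a n = x\<close>; the matching consists of the edges \<open>{a i, a (i + 1)}\<close> with \<open>i\<close> odd.\<close>

lemma smooth_circuit_matching:
  assumes K: "circuit K" and c2: "\<forall>f\<in>K. card f = 2" and sm: "smooth {K} ori" and x: "x \<in> \<Union>K"
  shows "\<exists>P\<subseteq>K. matching P \<and> \<Union>P = (if even (card K) then \<Union>K else \<Union>K - {x})"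
proof -
  define U where "U = \<Union>K"
  have fK: "finite K" using K by (simp add: circuit_def)
  have fU: "finite U" using graph_Union_edges[OF fK c2] by (simp add: graph_def U_def)
  have ori: "ori f \<in> f" if "f \<in> K" for f
    using sm that by (simp add: smooth_def orientation_def)
  have "\<forall>v\<in>U. \<exists>w. {v, w} \<in> K \<and> w \<noteq> v \<and> ori {v, w} = w"
  proof
    fix v assume "v \<in> U"
    then have "card {f\<in>K. v \<in> f \<and> ori f \<noteq> v} = 1" using sm unfolding smooth_def U_def by blast
    then have "{f\<in>K. v \<in> f \<and> ori f \<noteq> v} \<noteq> {}" by force
    then obtain f where f: "f \<in> K" "v \<in> f" "ori f \<noteq> v" by blast
    moreover obtain w where "f = {v, w}" "w \<noteq> v" using edge_other_end c2 f by metis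
    moreover have "ori f \<in> f" using ori f by blast
    ultimately show "\<exists>w. {v, w} \<in> K \<and> w \<noteq> v \<and> ori {v, w} = w" by auto
  qed
  \<comment> \<open>\<open>s v\<close> is the successor of \<open>v\<close> along the orientation;
    uniqueness of entering edges makes \<open>s\<close> injective below.\<close>
  then obtain s where s: "\<And>v. v \<in> U \<Longrightarrow> {v, s v} \<in> K \<and> s v \<noteq> v \<and> ori {v, s v} = s v"
    by metis
  have sU: "s v \<in> U" if "v \<in> U" for v using s[OF that] by (auto simp: U_def)
  have into: "f = h" if "f \<in> K" "h \<in> K" "ori f = ori h" for f h
  proof -
    have "ori f \<in> U" using ori that by (auto simp: U_def)
    then have "card {k\<in>K. ori f \<in> k \<and> ori k = ori f} = 1" using sm unfolding smooth_def U_def by blast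
    then obtain k where "{k\<in>K. ori f \<in> k \<and> ori k = ori f} = {k}" by (rule card_1_singletonE)
    then show ?thesis using that ori by (metis (mono_tags, lifting) mem_Collect_eq singletonD)
  qed
  have inj: "inj_on s U"
  proof (rule inj_onI)
    fix u v assume uv: "u \<in> U" "v \<in> U" "s u = s v"
    then have "{u, s u} = {v, s v}" using into s by metis
    then show "u = v" using uv by (auto simp: doubleton_eq_iff)
  qed
  define a where "a i = (s ^^ i) x" for i
  have a0: "a 0 = x" and aS: "a (Suc i) = s (a i)" for i by (simp_all add: a_def)
  have aU: "a i \<in> U" for i by (induction i) (use x sU in \<open>auto simp: a0 aS U_def\<close>)
  \<comment> \<open>Injectivity of \<open>s\<close> allows both indices to step back until the
    smaller one is 0.\<close>
  have period: "a (j - i) = x" if "a i = a j" "i \<le> j" for i j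
    using that
  proof (induction i arbitrary: j)
    case (Suc i)
    then obtain j' where j': "j = Suc j'" by (cases j) auto
    then have "a i = a j'" using Suc.prems inj aU by (simp add: aS inj_on_eq_iff)
    then show ?case using Suc.IH[of j'] Suc.prems j' by simp
  qed (simp add: a0)
  have "\<not> inj a" using fU aU finite_subset[of "range a" U] by (auto dest: finite_imageD)
  then obtain i j where "i < j" "a i = a j" unfolding inj_def by (metis nat_neq_iff)
  then have ex: "\<exists>n. 0 < n \<and> a n = x" using period by (intro exI[of _ "j - i"]) auto
  \<comment> \<open>\<open>n\<close> is the first return time to \<open>x\<close>. Indexing the
    orbit by \<open>1..n\<close>, with \<open>x\<close> as \<open>a n\<close>, gives each vertex a
    predecessor of index one less.\<close>
  define n where "n = (LEAST n. 0 < n \<and> a n = x)"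
  have n: "0 < n" "a n = x" using LeastI_ex[OF ex] by (simp_all add: n_def)
  have least: "m \<ge> n" if "0 < m" "a m = x" for m
    unfolding n_def using that by (intro Least_le) simp
  have inj_a: "inj_on a {1..n}"
  proof (rule linorder_inj_onI)
    fix i j assume "i < j" "i \<in> {1..n}" "j \<in> {1..n}"
    then show "a i \<noteq> a j" using period[of i j] least[of "j - i"] by force
  qed auto
  have "a i \<in> a ` {1..n}" for i
  proof (induction i)
    case 0
    then show ?case using n by (force simp: a0)
  next
    case (Suc i)
    then obtain k where k: "k \<in> {1..n}" "a i = a k" by auto
    show ?case
    proof (cases "k = n")
      case True
      then have "a (Suc i) = a 1" using k n by (simp add: aS a0)
      then show ?thesis using n by auto
    next
      case False
      then show ?thesis using k by (intro image_eqI[of _ _ "Suc k"]) (auto simp: aS)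
    qed
  qed
  then have range_a: "range a = a ` {1..n}" by auto
  \<comment> \<open>The edges at \<open>u\<close> lead to its successor or come from its
    predecessor, both on the orbit; by connectivity the orbit is then everything.\<close>
  have closed: "w \<in> range a" if uw: "u \<in> range a" "{u, w} \<in> K" "u \<noteq> w" for u w
  proof (cases "ori {u, w} = u")
    case False
    then have "ori {u, w} = w" using ori uw by blast
    have "card {f\<in>K. u \<in> f \<and> ori f \<noteq> u} = 1"
      using sm aU uw(1) unfolding smooth_def U_def by blast
    then obtain h where h: "{f\<in>K. u \<in> f \<and> ori f \<noteq> u} = {h}" by (rule card_1_singletonE)
    have "u \<in> U" using aU uw by auto
    then have "{u, w} = {u, s u}" using h s[of u] uw False by (metis (mono_tags, lifting) insertI1 mem_Collect_eq singletonD)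
    then have "w = s u" using uw by (auto simp: doubleton_eq_iff)
    then show ?thesis using uw aS by (metis rangeE rangeI)
  next
    case True
    obtain i where i: "i \<in> {1..n}" "u = a i" using uw(1) unfolding range_a by blast
    then obtain j where j: "u = s (a j)" using aS by (cases i) auto
    then have "{u, w} = {a j, u}" using into[of "{u, w}" "{a j, u}"] True uw s[OF aU, of j] by metis
    then have "w = a j" using uw by (auto simp: doubleton_eq_iff)
    then show ?thesis by simp
  qed
  have UK: "U = a ` {1..n}"
  proof
    show "U \<subseteq> a ` {1..n}"
    proof
      fix w assume "w \<in> U"
      then have "(x, w) \<in> (adj K)\<^sup>*" using K x unfolding circuit_def connected_graph_def U_def by blast
      then have "w \<in> range a"
      proof (induction rule: rtrancl_induct)
        case base
        show ?case using a0 by (metis rangeI)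
      next
        case (step y z)
        then have "{y, z} \<in> K" by (simp add: adj_def)
        then show ?case using closed step.IH by (cases "y = z") auto
      qed
      then show "w \<in> a ` {1..n}" using range_a by simp
    qed
  qed (use aU in auto)
  have cK: "card K = n"
  proof -
    have "(\<Sum>v\<in>\<Union>K. deg K v) = (\<Sum>v\<in>\<Union>K. 2)" using K by (intro sum.cong) (auto simp: circuit_def)
    then have "card K = card U" using sum_deg_Union[OF fK c2] by (simp add: U_def)
    then show ?thesis using inj_a UK by (simp add: card_image)
  qed
  define P where "P = (\<lambda>i. {a i, a (Suc i)}) ` {i. odd i \<and> i < n}"
  have "P \<subseteq> K" using s aU by (auto simp: P_def aS)
  moreover have "matching P"
    unfolding matching_def
  proof (intro ballI impI)
    fix f h assume "f \<in> P" "h \<in> P" "f \<noteq> h"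
    then obtain i j where ij: "odd i" "odd j" "i < n" "j < n" "i \<noteq> j"
      "f = {a i, a (Suc i)}" "h = {a j, a (Suc j)}"
      by (auto simp: P_def)
    have "i \<ge> 1" "j \<ge> 1" "i \<noteq> Suc j" "j \<noteq> Suc i" using ij by (auto elim: oddE)
    then show "f \<inter> h = {}" using ij inj_on_eq_iff[OF inj_a] by auto
  qed
  moreover have "\<Union>P = (if even (card K) then \<Union>K else \<Union>K - {x})"
  proof -
    \<comment> \<open>The index pairs are 1,2 then 3,4 and so on; for odd \<open>n\<close> they stop
      at \<open>n - 1\<close>, so that exactly \<open>a n = x\<close> is missed.\<close>
    have "\<Union>P = a ` {k. 1 \<le> k \<and> k \<le> (if even n then n else n - 1)}"
    proof (intro equalityI subsetI)
      fix w assume "w \<in> \<Union>P"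
      then obtain i where "odd i" "i < n" "w = a i \<or> w = a (Suc i)" by (auto simp: P_def)
      moreover from this have "1 \<le> i" "Suc i \<le> (if even n then n else n - 1)"
        by (auto elim!: oddE)
      ultimately show "w \<in> a ` {k. 1 \<le> k \<and> k \<le> (if even n then n else n - 1)}" by auto
    next
      fix w assume "w \<in> a ` {k. 1 \<le> k \<and> k \<le> (if even n then n else n - 1)}"
      then obtain k where k: "1 \<le> k" "k \<le> (if even n then n else n - 1)" "w = a k" by auto
      show "w \<in> \<Union>P"
      proof (cases "odd k")
        case True
        then have "k < n" using k n by (cases "k = n") (auto split: if_splits)
        then show ?thesis using True k by (auto simp: P_def)
      next
        case False
        then obtain i where i: "k = Suc i" "odd i" using k by (cases k) auto
        then have "i < n" using k n by (auto split: if_splits)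
        then show ?thesis using i k by (auto simp: P_def)
      qed
    qed
    moreover have "{k. 1 \<le> k \<and> k \<le> n} = {1..n}" by auto
    moreover have "{k. 1 \<le> k \<and> k \<le> n - 1} = {1..n} - {n}" using n by auto
    moreover have "a ` ({1..n} - {n}) = a ` {1..n} - {x}"
      using inj_on_image_set_diff[OF inj_a, of "{1..n}" "{n}"] n by simp
    ultimately show ?thesis using cK UK by (auto simp: U_def)
  qed
  ultimately show ?thesis by blast
qed

text \<open>Smoothness is stated circuit by circuit. In a 2-regular graph each vertex lies on a
  component containing all its edges, so the balance carries over to \<open>H\<close>.\<close>

lemma smooth_two_regular:
  assumes fin: "finite H" and c2: "\<forall>f\<in>H. card f = 2" and d2: "\<forall>v\<in>\<Union>H. deg H v = 2"
    and sm: "smooth (circuits_of H) ori"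
  shows "\<forall>f\<in>H. ori f \<in> f"
    and "\<forall>v\<in>\<Union>H. card {f\<in>H. v \<in> f \<and> ori f = v} = 1 \<and> card {f\<in>H. v \<in> f \<and> ori f \<noteq> v} = 1"
proof -
  have comp: "\<exists>K\<in>circuits_of H. v \<in> \<Union>K \<and> {f\<in>K. v \<in> f} = {f\<in>H. v \<in> f}" if v: "v \<in> \<Union>H" for v
  proof -
    obtain K where K: "K \<in> circuits_of H" "v \<in> \<Union>K"
      using two_regular_component[OF fin c2 d2 v] by blast
    then have "{f\<in>K. v \<in> f} = {f\<in>H. v \<in> f}" by (auto simp: circuits_of_def)
    with K show ?thesis by blast
  qed
  show "\<forall>f\<in>H. ori f \<in> f"
  proof
    fix f assume f: "f \<in> H"
    then obtain v where v: "v \<in> f" using c2 by fastforce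
    then obtain K where K: "K \<in> circuits_of H" "{f\<in>K. v \<in> f} = {f\<in>H. v \<in> f}"
      using comp f by blast
    then have "f \<in> K" using f v by blast
    then show "ori f \<in> f" using sm K(1) by (auto simp: smooth_def orientation_def)
  qed
  show "\<forall>v\<in>\<Union>H. card {f\<in>H. v \<in> f \<and> ori f = v} = 1 \<and> card {f\<in>H. v \<in> f \<and> ori f \<noteq> v} = 1"
  proof
    fix v assume "v \<in> \<Union>H"
    then obtain K where K: "K \<in> circuits_of H" "v \<in> \<Union>K" "{f\<in>K. v \<in> f} = {f\<in>H. v \<in> f}"
      using comp by blast
    have "card {f\<in>K. v \<in> f \<and> ori f = v} = 1 \<and> card {f\<in>K. v \<in> f \<and> ori f \<noteq> v} = 1"
      using sm K(1,2) unfolding smooth_def by blast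
    moreover have "{f\<in>K. v \<in> f \<and> ori f = v} = {f\<in>H. v \<in> f \<and> ori f = v}"
      "{f\<in>K. v \<in> f \<and> ori f \<noteq> v} = {f\<in>H. v \<in> f \<and> ori f \<noteq> v}"
      using K(3) by blast+
    ultimately show "card {f\<in>H. v \<in> f \<and> ori f = v} = 1 \<and> card {f\<in>H. v \<in> f \<and> ori f \<noteq> v} = 1"
      by simp
  qed
qed

text \<open>Members of \<open>circuits_of H\<close> are connected and closed under incident edges of
  \<open>H\<close>, so a common vertex forces each to contain the other.\<close>

lemma circuits_of_disjoint:
  assumes c2: "\<forall>f\<in>H. card f = 2" and "K \<in> circuits_of H" "L \<in> circuits_of H" "K \<noteq> L"
  shows "\<Union>K \<inter> \<Union>L = {}"
proof (rule ccontr)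
  have sub: "K \<subseteq> L" if K: "K \<in> circuits_of H" and L: "L \<in> circuits_of H" and v: "v \<in> \<Union>K" "v \<in> \<Union>L" for K L v
  proof
    fix f assume f: "f \<in> K"
    then obtain w where w: "w \<in> f" using c2 K by (fastforce simp: circuits_of_def)
    have closed: "h \<in> L" if "h \<in> H" "y \<in> h" "y \<in> \<Union>L" for h y
      using L that by (auto simp: circuits_of_def)
    have "(v, w) \<in> (adj K)\<^sup>*"
      using K v(1) f w unfolding circuits_of_def circuit_def connected_graph_def by blast
    then have "w \<in> \<Union>L"
    proof (induction rule: rtrancl_induct)
      case base
      show ?case by (rule v(2))
    next
      case (step y z)
      then have "{y, z} \<in> H" using K by (auto simp: adj_def circuits_of_def)
      then have "{y, z} \<in> L" using closed[of _ y] step.IH by blast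
      then show ?case by blast
    qed
    moreover have "f \<in> H" using f K by (auto simp: circuits_of_def)
    ultimately show "f \<in> L" using closed w by blast
  qed
  assume "\<Union>K \<inter> \<Union>L \<noteq> {}"
  then obtain v where "v \<in> \<Union>K" "v \<in> \<Union>L" by blast
  then have "K = L" using sub assms by (meson subset_antisym)
  then show False using assms(4) by blast
qed

lemma card_Union_matching:
  assumes "finite M" "matching M" "\<forall>f\<in>M. card f = 2"
  shows "card (\<Union>M) = 2 * card M"
proof -
  have "card (\<Union>M) = (\<Sum>f\<in>M. card f)"
    using assms by (intro card_Union_disjoint)
      (auto simp: matching_def pairwise_def disjnt_def intro: card_ge_0_finite)
  then show ?thesis using assms(3) by simp
qed

text \<open>Matchings of the single circuits unite to \<open>P\<close>, which covers all vertices
  but \<open>x1\<close> and \<open>x2\<close>. Maximality gives \<open>card P \<le> card M\<close>,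
  and a matching covers twice as many vertices as it has edges, so \<open>M\<close> covers the same
  set.\<close>

lemma maximum_matching_covers:
  assumes fin: "finite C" and c2: "\<forall>f\<in>C. card f = 2" and d2: "\<forall>v\<in>\<Union>C. deg C v = 2"
    and sm: "smooth (circuits_of C) ori"
    and N: "N1 \<in> circuits_of C" "N2 \<in> circuits_of C" "N1 \<noteq> N2" "odd (card N1)" "odd (card N2)"
    and even: "\<forall>N\<in>circuits_of C. odd (card N) \<longrightarrow> N = N1 \<or> N = N2"
    and x: "x1 \<in> \<Union>N1" "x2 \<in> \<Union>N2"
    and M: "maximum_matching {f\<in>C. x1 \<notin> f \<and> x2 \<notin> f} M"
  shows "\<Union>M = \<Union>C - {x1, x2}"
proof -
  have "\<forall>K\<in>circuits_of C. \<exists>P\<subseteq>K. matching P \<and> \<Union>P = \<Union>K - {x1, x2}"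
  proof
    fix K assume K: "K \<in> circuits_of C"
    have cK: "circuit K" "K \<subseteq> C" using K by (auto simp: circuits_of_def)
    have smK: "smooth {K} ori" using sm K by (auto simp: smooth_def)
    have c2K: "\<forall>f\<in>K. card f = 2" using c2 cK by blast
    \<comment> \<open>\<open>y\<close> is the vertex to leave out: \<open>x1\<close> or
      \<open>x2\<close> on the odd circuits, arbitrary on the even ones, where nothing is
      omitted.\<close>
    obtain y where y: "y \<in> \<Union>K" "K = N1 \<Longrightarrow> y = x1" "K = N2 \<Longrightarrow> y = x2"
    proof (cases "K = N1 \<or> K = N2")
      case True
      then show ?thesis using that x N(3) by blast
    next
      case False
      obtain f where f: "f \<in> K" using cK by (auto simp: circuit_def)
      then obtain v where "v \<in> f" using c2K by fastforce
      then show ?thesis using that[of v] False f by blast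
    qed
    obtain P where P: "P \<subseteq> K" "matching P" "\<Union>P = (if even (card K) then \<Union>K else \<Union>K - {y})"
      using smooth_circuit_matching[OF cK(1) c2K smK y(1)] by blast
    have "\<Union>P = \<Union>K - {x1, x2}"
    proof -
      have out: "x1 \<notin> \<Union>K" if "K \<noteq> N1" using circuits_of_disjoint[OF c2 K N(1) that] x by blast
      have out2: "x2 \<notin> \<Union>K" if "K \<noteq> N2" using circuits_of_disjoint[OF c2 K N(2) that] x by blast
      consider "K = N1" | "K = N2" | "K \<noteq> N1" "K \<noteq> N2" by blast
      then show ?thesis
        using P(3) y N even K out out2 by cases auto
    qed
    then show "\<exists>P\<subseteq>K. matching P \<and> \<Union>P = \<Union>K - {x1, x2}" using P by blast
  qed
  then obtain p where p: "\<And>K. K \<in> circuits_of C \<Longrightarrow> p K \<subseteq> K \<and> matching (p K) \<and> \<Union>(p K) = \<Union>K - {x1, x2}"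
    by metis
  have comp: "K \<subseteq> C" if "K \<in> circuits_of C" for K using that by (simp add: circuits_of_def)
  define P where "P = (\<Union>K\<in>circuits_of C. p K)"
  have UP: "\<Union>P = \<Union>C - {x1, x2}"
  proof
    show "\<Union>P \<subseteq> \<Union>C - {x1, x2}"
    proof
      fix v assume "v \<in> \<Union>P"
      then obtain K where K: "K \<in> circuits_of C" "v \<in> \<Union>(p K)" by (auto simp: P_def)
      then show "v \<in> \<Union>C - {x1, x2}" using p[OF K(1)] comp[OF K(1)] by blast
    qed
    show "\<Union>C - {x1, x2} \<subseteq> \<Union>P"
    proof
      fix v assume v: "v \<in> \<Union>C - {x1, x2}"
      then obtain K where K: "K \<in> circuits_of C" "v \<in> \<Union>K"
        using two_regular_component[OF fin c2 d2] by blast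
      then have "v \<in> \<Union>(p K)" using p[OF K(1)] v by blast
      then show "v \<in> \<Union>P" using K by (auto simp: P_def)
    qed
  qed
  have PC: "P \<subseteq> C"
    unfolding P_def
  proof (rule UN_least)
    fix K assume "K \<in> circuits_of C"
    then show "p K \<subseteq> C" using p[of K] comp[of K] by (meson order_trans)
  qed
  have mP: "matching P"
    unfolding matching_def
  proof (intro ballI impI)
    fix f h assume "f \<in> P" "h \<in> P" and ne: "f \<noteq> h"
    then obtain K L where KL: "K \<in> circuits_of C" "L \<in> circuits_of C" "f \<in> p K" "h \<in> p L"
      by (auto simp: P_def)
    show "f \<inter> h = {}"
    proof (cases "K = L")
      case True
      then show ?thesis using KL p[OF KL(1)] ne unfolding matching_def by blast
    next
      case False
      have "f \<in> K" "h \<in> L"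
        using p[OF KL(1), THEN conjunct1] p[OF KL(2), THEN conjunct1] KL by auto
      then show ?thesis using circuits_of_disjoint[OF c2 KL(1,2) False] by blast
    qed
  qed
  have "P \<subseteq> {f\<in>C. x1 \<notin> f \<and> x2 \<notin> f}" using UP PC by blast
  then have "card P \<le> card M" using M mP by (simp add: maximum_matching_def)
  moreover have MC: "M \<subseteq> C" "matching M" using M by (auto simp: maximum_matching_def)
  moreover have "card (\<Union>M) = 2 * card M" "card (\<Union>P) = 2 * card P"
    using MC PC mP c2 fin by (auto intro!: card_Union_matching intro: finite_subset)
  moreover have "\<Union>M \<subseteq> \<Union>C - {x1, x2}" using M by (auto simp: maximum_matching_def)
  moreover have "finite (\<Union>C - {x1, x2})" using graph_Union_edges[OF fin c2] by (simp add: graph_def)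
  ultimately show ?thesis using UP by (intro card_seteq) auto
qed


subsection \<open>The theorem\<close>

theorem theorem3:
  fixes V :: "'v set" and E C N1 N2 M :: "'v set set" and x1 x2 :: 'v
    and o1 o2 :: "'v set \<Rightarrow> 'v"
  assumes "cubic V E"
    and "cyclically_k_edge_connected V E 4"
    and "two_factor V E C"
    and "N1 \<in> circuits_of C" and "N2 \<in> circuits_of C" and "N1 \<noteq> N2"
    and "odd (card N1)" and "odd (card N2)"
    and "\<forall>N\<in>circuits_of C. odd (card N) \<longrightarrow> N = N1 \<or> N = N2"
    and "{x1, x2} \<in> E" and "x1 \<in> \<Union>N1" and "x2 \<in> \<Union>N2"
    and "maximum_matching {f\<in>C. x1 \<notin> f \<and> x2 \<notin> f} M"
    and "smooth (circuits_of (((E - C) - {{x1, x2}}) \<union> M)) o1"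
    and "smooth (circuits_of C) o2"
    and "\<forall>z\<in>{f\<in>N1. x1 \<notin> f \<and> (\<exists>y. {x1, y} \<in> N1 \<and> y \<in> f)}
           \<union> {f\<in>N2. x2 \<notin> f \<and> (\<exists>y. {x2, y} \<in> N2 \<and> y \<in> f)}. o1 z = o2 z"
  shows "frank_number V E = 2"
proof -
  note N = assms(4,5,6,7,8) and x1 = assms(11) and x2 = assms(12)
  note c = assms(1) and cyc = assms(2) and agree = assms(16)
  let ?e = "{x1, x2}"

  \<comment> \<open>The 2-factor \<open>C\<close> and the subgraph \<open>D\<close>\<close>
  have gr: "graph V E" using c by (simp add: cubic_def)
  have finE: "finite E" using gr by (rule finite_edges)
  have edge: "f \<subseteq> V" "card f = 2" if "f \<in> E" for f using gr that by (auto simp: graph_def)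
  have CE: "C \<subseteq> E" and degC: "\<And>v. v \<in> V \<Longrightarrow> deg C v = 2" using assms(3) by (auto simp: two_factor_def)
  have finC: "finite C" using CE finE by (rule finite_subset)
  have UC: "\<Union>C = V"
  proof
    show "\<Union>C \<subseteq> V" using CE edge by blast
    show "V \<subseteq> \<Union>C"
    proof
      fix v assume "v \<in> V"
      then have "card {f\<in>C. v \<in> f} \<noteq> 0" using degC by (simp add: deg_def)
      then have "{f\<in>C. v \<in> f} \<noteq> {}" by (metis card.empty)
      then show "v \<in> \<Union>C" by blast
    qed
  qed
  have c2C: "\<forall>f\<in>C. card f = 2" and d2C: "\<forall>v\<in>\<Union>C. deg C v = 2" using CE edge degC UC by auto
  have comp: "f \<in> K" if "K \<in> circuits_of C" "f \<in> C" "v \<in> f" "v \<in> \<Union>K" for f K v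
    using that by (auto simp: circuits_of_def)
  have NC: "N1 \<subseteq> C" "N2 \<subseteq> C" using N by (auto simp: circuits_of_def)
  have disj: "\<Union>N1 \<inter> \<Union>N2 = {}" using circuits_of_disjoint[OF c2C N(1-3)] .
  then have x12: "x1 \<noteq> x2" using x1 x2 by blast
  have eE: "?e \<in> E" by (fact assms(10))
  \<comment> \<open>An edge of \<open>C\<close> from \<open>x1\<close> to \<open>x2\<close> would
    make the two disjoint circuits share a vertex.\<close>
  have eC: "?e \<notin> C"
  proof
    assume "?e \<in> C"
    then have "?e \<in> N1" using comp[OF N(1), of ?e x1] x1 by blast
    then show False using disj x2 by blast
  qed
  have x1V: "x1 \<in> V" using edge(1)[OF eE] by simp
  have UM: "\<Union>M = V - {x1, x2}"
    using maximum_matching_covers[OF finC c2C d2C assms(15) N assms(9) x1 x2 assms(13)] UC by simp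
  have MC: "M \<subseteq> C" and mM: "matching M" using assms(13) by (auto simp: maximum_matching_def)
  have F1: "card {f\<in>E - C. v \<in> f} = 1" if v: "v \<in> V" for v
  proof -
    have "{f\<in>E - C. v \<in> f} = {f\<in>E. v \<in> f} - {f\<in>C. v \<in> f}" by auto
    moreover have "card ({f\<in>E. v \<in> f} - {f\<in>C. v \<in> f}) = card {f\<in>E. v \<in> f} - card {f\<in>C. v \<in> f}"
      using CE finC by (intro card_Diff_subset) auto
    ultimately show ?thesis using c degC[OF v] v by (auto simp: cubic_def deg_def)
  qed
  define D where "D = ((E - C) - {?e}) \<union> M"
  have DE: "D \<subseteq> E" using MC CE by (auto simp: D_def)
  \<comment> \<open>\<open>E - C\<close> is a perfect matching, and its edge at \<open>x1\<close>
    and at \<open>x2\<close> is \<open>?e\<close>.\<close>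
  have F_end: "f = ?e" if f: "f \<in> E - C" "x1 \<in> f \<or> x2 \<in> f" for f
  proof -
    obtain x where x: "x \<in> ?e" "x \<in> f" using f by blast
    then obtain k where k: "{f\<in>E - C. x \<in> f} = {k}"
      using F1[of x] edge(1)[OF eE] by (metis card_1_singletonE subsetD)
    have "f \<in> {f\<in>E - C. x \<in> f}" "?e \<in> {f\<in>E - C. x \<in> f}" using x f eE eC by auto
    then show ?thesis unfolding k by simp
  qed
  have UD: "\<Union>D \<subseteq> V - {x1, x2}"
  proof
    fix v assume "v \<in> \<Union>D"
    then obtain f where f: "f \<in> D" "v \<in> f" by blast
    show "v \<in> V - {x1, x2}"
    proof (cases "f \<in> M")
      case True
      then show ?thesis using UM f by blast
    next
      case False
      then have "f \<in> E - C" "f \<noteq> ?e" using f by (auto simp: D_def)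
      then show ?thesis using F_end[of f] edge(1)[of f] f by auto
    qed
  qed
  \<comment> \<open>Off \<open>x1\<close> and \<open>x2\<close> each vertex has one edge in
    \<open>E - C\<close> and a different one in \<open>M\<close>.\<close>
  have d2D: "\<forall>v\<in>\<Union>D. deg D v = 2"
  proof
    fix v assume "v \<in> \<Union>D"
    then have v: "v \<in> V" "v \<noteq> x1" "v \<noteq> x2" using UD by auto
    then obtain m where m: "m \<in> M" "v \<in> m" using UM by blast
    then have "{f\<in>M. v \<in> f} = {m}" using mM unfolding matching_def by blast
    moreover obtain k where k: "{f\<in>E - C. v \<in> f} = {k}"
      using F1[OF v(1)] by (rule card_1_singletonE)
    moreover have "{f\<in>D. v \<in> f} = {f\<in>E - C. v \<in> f} \<union> {f\<in>M. v \<in> f}"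
      using v by (auto simp: D_def)
    moreover have "m \<noteq> k" using m MC k by blast
    ultimately show "deg D v = 2" by (simp add: deg_def)
  qed
  have finD: "finite D" using DE finE by (rule finite_subset)
  have c2D: "\<forall>f\<in>D. card f = 2" using DE edge by blast
  note smD = smooth_two_regular[OF finD c2D d2D assms(14)[folded D_def]]
    and smC = smooth_two_regular[OF finC c2C d2C assms(15)]

  \<comment> \<open>The flows \<open>2C + D\<close> and \<open>C - 2D\<close> and their
    orientations\<close>
  let ?a = "unit_flow C o2" and ?b = "unit_flow D o1"
  \<comment> \<open>The coefficients \<open>1\<close> and \<open>-2\<close> are written out to match
    the form of \<open>flow_lincomb\<close>.\<close>
  let ?p = "\<lambda>f v. 2 * ?a f v + 1 * ?b f v" and ?q = "\<lambda>f v. 1 * ?a f v + (-2) * ?b f v"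
  have flp: "flow V E ?p" and flq: "flow V E ?q"
    using flow_unit_flow[OF gr CE smC] flow_unit_flow[OF gr DE smD] by (rule flow_lincomb)+
  have vC: "?a f v = (if o2 f = v then 1 else - 1)" if "f \<in> C" "v \<in> f" for f v
    using that by (simp add: unit_flow_def)
  have vD: "?b f v = (if o1 f = v then 1 else - 1)" if "f \<in> D" "v \<in> f" for f v
    using that by (simp add: unit_flow_def)
  have v0: "f \<notin> C \<Longrightarrow> ?a f v = 0" "f \<notin> D \<Longrightarrow> ?b f v = 0" for f v
    by (simp_all add: unit_flow_def)
  have eD: "?e \<notin> D" using eC MC by (auto simp: D_def)
  have CD: "f \<in> D \<longleftrightarrow> f \<in> M" if "f \<in> C" for f using that by (auto simp: D_def)
  have CorD: "f \<in> C \<or> f \<in> D" if "f \<in> E" "f \<noteq> ?e" for f using that by (auto simp: D_def)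
  \<comment> \<open>The two flows have sizes 2 and 1 on \<open>C\<close> alone, and 1 and 2 on
    \<open>D\<close> alone. On edges of both, they have sizes 3 and 1 if \<open>o1\<close> and
    \<open>o2\<close> agree, and 1 and 3 otherwise.\<close>
  have nz: "?p f v \<noteq> 0 \<and> ?q f v \<noteq> 0" if "f \<in> E" "f \<noteq> ?e" "v \<in> f" for f v
    using CorD[OF that(1,2)] that(3) by (auto simp: unit_flow_def)
  obtain oa where oa: "orientation E oa" "oa ?e = x2" "\<forall>f\<in>E. f \<noteq> ?e \<longrightarrow> ?p f (oa f) > 0"
    and oa_val: "\<And>f v. f \<in> E \<Longrightarrow> f \<noteq> ?e \<Longrightarrow> v \<in> f \<Longrightarrow> (oa f = v \<longleftrightarrow> ?p f v > 0) \<and> ?p f (oa f) = \<bar>?p f v\<bar>"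
    using flow_orientation[OF gr flp, of ?e x2] nz by blast
  obtain ob where ob: "orientation E ob" "ob ?e = x1" "\<forall>f\<in>E. f \<noteq> ?e \<longrightarrow> ?q f (ob f) > 0"
    and ob_val: "\<And>f v. f \<in> E \<Longrightarrow> f \<noteq> ?e \<Longrightarrow> v \<in> f \<Longrightarrow> (ob f = v \<longleftrightarrow> ?q f v > 0) \<and> ?q f (ob f) = \<bar>?q f v\<bar>"
    using flow_orientation[OF gr flq, of ?e x1] nz by blast
  have zero: "?p ?e v = 0" "?q ?e v = 0" for v using v0 eC eD by simp_all
  note del_a = deletable_if_flow[OF c cyc flp oa(1,3) eE zero(1)]
    and del_b = deletable_if_flow[OF c cyc flq ob(1,3) eE zero(2)]

  \<comment> \<open>Deletability of every edge\<close>
  have easy_a: "deletable V E oa g" if g: "g \<in> E" "x1 \<notin> g" "x2 \<notin> g" "v \<in> g" "\<bar>?p g v\<bar> = 1" for g v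
  proof (rule del_a[OF g(1)])
    have "?p g (oa g) = \<bar>?p g v\<bar>" using oa_val[of g v] g by blast
    then show "?p g (oa g) \<le> 1 \<or> ?p g (oa g) = 2 \<and> ?e \<inter> g \<noteq> {} \<and>
      (\<forall>y\<in>g - ?e. \<exists>z\<in>E. y \<in> z \<and> z \<noteq> g \<and> ?p z (oa z) > 1)" using g(5) by simp
  qed (use g in auto)
  have easy_b: "deletable V E ob g" if g: "g \<in> E" "x1 \<notin> g" "x2 \<notin> g" "v \<in> g" "\<bar>?q g v\<bar> = 1" for g v
  proof (rule del_b[OF g(1)])
    have "?q g (ob g) = \<bar>?q g v\<bar>" using ob_val[of g v] g by blast
    then show "?q g (ob g) \<le> 1 \<or> ?q g (ob g) = 2 \<and> ?e \<inter> g \<noteq> {} \<and>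
      (\<forall>y\<in>g - ?e. \<exists>z\<in>E. y \<in> z \<and> z \<noteq> g \<and> ?q z (ob z) > 1)" using g(5) by simp
  qed (use g in auto)
  \<comment> \<open>On \<open>g\<close> both flows have the sign of \<open>C\<close>, so
    \<open>oa\<close> and \<open>ob\<close> direct \<open>g\<close> alike, but \<open>?e\<close>
    oppositely. Hence exactly one of them directs \<open>g\<close> and \<open>?e\<close> alike at
    \<open>x\<close>, as \<open>deletable_if_flow\<close> requires.\<close>
  have at_end: "deletable V E oa g \<or> deletable V E ob g"
    if x: "x \<in> ?e" and K: "K \<in> circuits_of C" "x \<in> \<Union>K"
      and agr: "\<And>z y. z \<in> K \<Longrightarrow> x \<notin> z \<Longrightarrow> {x, y} \<in> K \<Longrightarrow> y \<in> z \<Longrightarrow> o1 z = o2 z"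
      and g: "g \<in> C" "x \<in> g" for x K g
  proof -
    have gE: "g \<in> E" using g CE by blast
    have ge: "g \<noteq> ?e" using g eC by blast
    have gM: "g \<notin> M" using UM x g by auto
    have gD: "g \<notin> D" using gM CD g by blast
    have gK: "g \<in> K" using comp[OF K(1) g(1) g(2) K(2)] .
    obtain y where y: "g = {x, y}" "y \<noteq> x" using edge_other_end[OF edge(2)[OF gE] g(2)] by metis
    have ye: "y \<notin> ?e" using ge x y by auto
    have common: "x' = x" if "x' \<in> ?e" "x' \<in> g" for x' using that ye y by auto
    have vals: "?p g x = 2 * ?a g x" "?q g x = ?a g x" "?a g x = (if o2 g = x then 1 else - 1)"
      using v0(2)[OF gD] vC[OF g] by simp_all
    have ga: "oa g = x \<longleftrightarrow> o2 g = x" "?p g (oa g) = 2"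
      using oa_val[OF gE ge g(2)] vals by auto
    have gb: "ob g = x \<longleftrightarrow> o2 g = x" "?q g (ob g) = 1"
      using ob_val[OF gE ge g(2)] vals by auto
    show ?thesis
    proof (cases "o2 g = x \<longleftrightarrow> ob ?e = x")
      case True
      have "deletable V E ob g"
      proof (rule del_b[OF gE])
        show "?q g (ob g) \<le> 1 \<or> ?q g (ob g) = 2 \<and> ?e \<inter> g \<noteq> {} \<and>
          (\<forall>y\<in>g - ?e. \<exists>z\<in>E. y \<in> z \<and> z \<noteq> g \<and> ?q z (ob z) > 1)" using gb(2) by simp
        show "(ob ?e = x') = (ob g = x')" if "x' \<in> ?e" "x' \<in> g" for x'
          using common[OF that] True gb(1) by simp
      qed
      then show ?thesis ..
    next
      case False
      then have same: "oa ?e = x \<longleftrightarrow> oa g = x" using x x12 ga(1) oa(2) ob(2) by auto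
      have "deletable V E oa g"
      proof (rule del_a[OF gE])
        show "(oa ?e = x') = (oa g = x')" if "x' \<in> ?e" "x' \<in> g" for x'
          using common[OF that] same by simp
        \<comment> \<open>The matching edge \<open>z\<close> at the far end \<open>y\<close> of
          \<open>g\<close> avoids \<open>x\<close>, so \<open>o1\<close> and \<open>o2\<close> agree
          on it by hypothesis, and \<open>2C + D\<close> has size 3 there.\<close>
        have "\<exists>z\<in>E. w \<in> z \<and> z \<noteq> g \<and> ?p z (oa z) > 1" if w: "w \<in> g - ?e" for w
        proof -
          have wy: "w = y" using w y x by auto
          have "y \<in> V" using edge(1)[OF gE] y by simp
          then obtain z where z: "z \<in> M" "y \<in> z" using UM ye by blast
          then have zC: "z \<in> C" "z \<in> D" using MC by (auto simp: D_def)
          have "z \<in> K" using comp[OF K(1) zC(1) z(2)] gK y by blast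
          moreover have xz: "x \<notin> z" using z(1) UM x by blast
          ultimately have o12: "o1 z = o2 z" using agr[of z y] gK y z by simp
          have ze: "z \<in> E" "z \<noteq> ?e" using zC CE eC by auto
          have "\<bar>?p z y\<bar> = 3" using vC[OF zC(1) z(2)] vD[OF zC(2) z(2)] o12 by simp
          then have "?p z (oa z) > 1" using oa_val[OF ze z(2)] by simp
          then show ?thesis using ze z wy gM by blast
        qed
        then show "?p g (oa g) \<le> 1 \<or> ?p g (oa g) = 2 \<and> ?e \<inter> g \<noteq> {} \<and>
          (\<forall>y\<in>g - ?e. \<exists>z\<in>E. y \<in> z \<and> z \<noteq> g \<and> ?p z (oa z) > 1)"
          using ga(2) x g(2) by blast
      qed
      then show ?thesis ..
    qed
  qed
  have all: "deletable V E oa g \<or> deletable V E ob g" if g: "g \<in> E" for g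
  proof -
    obtain v where v: "v \<in> g" using edge(2)[OF g] by fastforce
    consider "g = ?e" | "g \<notin> C" "g \<noteq> ?e" | "g \<in> M" | "g \<in> C" "g \<notin> M" "x1 \<notin> g" "x2 \<notin> g"
      | "g \<in> C" "x1 \<in> g" | "g \<in> C" "x2 \<in> g" by blast
    then show ?thesis
    proof cases
      case 1
      \<comment> \<open>The value 0 meets the bound, and the condition on directions is vacuous for
        \<open>g = e\<close>.\<close>
      have "deletable V E oa ?e" by (rule del_a[OF eE]) (use zero in auto)
      then show ?thesis using 1 by simp
    next
      case 2
      then have "g \<in> D" using CorD g by blast
      then have "x1 \<notin> g" "x2 \<notin> g" using UD by auto
      moreover have "\<bar>?p g v\<bar> = 1" using v0(1)[OF 2(1)] vD[OF \<open>g \<in> D\<close> v] by simp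
      ultimately show ?thesis using easy_a g v by blast
    next
      case 3
      then have gC: "g \<in> C" and gD: "g \<in> D" using MC by (auto simp: D_def)
      have nx: "x1 \<notin> g" "x2 \<notin> g" using 3 UM by auto
      have in2: "o2 g \<in> g" using smC(1) gC by blast
      show ?thesis
      proof (cases "o1 g = o2 g")
        case True
        then have "\<bar>?q g (o2 g)\<bar> = 1" using vC[OF gC in2] vD[OF gD in2] by simp
        then show ?thesis using easy_b[OF g nx in2] by blast
      next
        case False
        then have "\<bar>?p g (o2 g)\<bar> = 1" using vC[OF gC in2] vD[OF gD in2] by simp
        then show ?thesis using easy_a[OF g nx in2] by blast
      qed
    next
      case 4
      then have "g \<notin> D" using CD by blast
      then have "\<bar>?q g v\<bar> = 1" using v0(2) vC[OF 4(1) v] by simp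
      then show ?thesis using easy_b[OF g 4(3,4) v] by blast
    next
      case 5
      show ?thesis
        by (rule at_end[OF _ N(1) x1 _ 5]) (use agree in blast)+
    next
      case 6
      show ?thesis
        by (rule at_end[OF _ N(2) x2 _ 6]) (use agree in blast)+
    qed
  qed

  \<comment> \<open>The exact value of the Frank number\<close>
  show ?thesis
    unfolding frank_number_def
  proof (rule Least_equality)
    define os where "os i = (if i = 0 then oa else ob)" for i :: nat
    have "deletable V E (os 0) f \<or> deletable V E (os 1) f" if "f \<in> E" for f
      using all[OF that] by (simp add: os_def)
    then have "\<forall>f\<in>E. \<exists>i<2. deletable V E (os i) f" by (metis one_less_numeral_iff semiring_norm(76) zero_less_numeral)
    moreover have "\<forall>i<2. orientation E (os i)" using oa(1) ob(1) by (simp add: os_def)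
    ultimately show "\<exists>os::nat \<Rightarrow> 'v set \<Rightarrow> 'v. (\<forall>i<2. orientation E (os i)) \<and> (\<forall>e\<in>E. \<exists>i<2. deletable V E (os i) e)"
      by blast
  next
    fix k assume "\<exists>os::nat \<Rightarrow> 'v set \<Rightarrow> 'v. (\<forall>i<k. orientation E (os i)) \<and> (\<forall>e\<in>E. \<exists>i<k. deletable V E (os i) e)"
    then obtain os :: "nat \<Rightarrow> 'v set \<Rightarrow> 'v" where os: "\<forall>i<k. orientation E (os i)" "\<forall>e\<in>E. \<exists>i<k. deletable V E (os i) e"
      by blast
    show "2 \<le> k"
    proof (rule ccontr)
      assume lt: "\<not> 2 \<le> k"
      \<comment> \<open>Only index 0 would be available, and \<open>?e\<close> shows that it is, so
        one orientation would have to serve all edges.\<close>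
      then have k0: "i = 0" if "i < k" for i using that lt by linarith
      obtain i where "i < k" using os(2) eE by blast
      then have "orientation E (os 0)" using os(1) k0 by metis
      then obtain g where "g \<in> E" "\<not> deletable V E (os 0) g"
        using exists_nondeletable[OF c x1V] by blast
      then show False using os(2) k0 by metis
    qed
  qed
qed

end
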